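(* For fixed integers $m>1$ and $1\le i\le m$, the function $x\mapsto r_{i,m}(x)$ is continuous at every $x\in\mathbb{R}$.
   Context: For integers $n$ and $k$ (with $n$ possibly zero or negative), let $\binom{n}{k}=0$ if $k<0$, $\binom{n}{0}=1$, and $\binom{n}{k}=\frac{1}{k!}\prod_{l=0}^{k-1}(n-l)$ if $k>0$; and let $\left(\!\binom{n}{k}\!\right)=\binom{n+k-1}{k}$. For an integer $m\ge 1$ and any integer $a$, let $\Lambda_m(a)$ be the $(m+1)\times(m+1)$ matrix whose $(p,q)$ entry is $\left(\!\binom{a}{m+2-p-q}\!\right)$, $1\le p,q\le m+1$. Every real $x$ has a continued fraction $x=[c_1,c_2,\dots]=c_1+\cfrac{1}{c_2+\cdots}$ with $c_1=\lfloor x\rfloor$ (possibly zero or negative), and, if $x$ is not an integer, $[c_2,c_3,\dots]$ the usual continued fraction (with positive integer entries) of $\frac{1}{x-\lfloor x\rfloor}>1$. For rational $x=[c_1,\dots,c_n]$, let $X=\Lambda_m(c_1)\cdots\Lambda_m(c_n)$; the numbers $r_{i,m}(x)$, $0\le i\le m$, are defined by $$(r_{m,m}(x),r_{m-1,m}(x),\dots,r_{1,m}(x),r_{0,m}(x))^\top=\frac{1}{X_{m+1,1}}\,(\text{first column of }X),$$ so $r_{0,m}(x)=1$. For irrational $x$ with convergents $x_n=[c_1,\dots,c_n]$, define $r_{i,m}(x)=\lim_{n\to\infty}r_{i,m}(x_n)$; this limit is known to exist. *)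

theory Defs
  imports Complex_Main "Jordan_Normal_Form.Matrix"
begin

definition int_binom :: "int \<Rightarrow> int \<Rightarrow> real" where
  "int_binom n k = (if k < 0 then 0 else of_int n gchoose nat k)"

definition multichoose :: "int \<Rightarrow> int \<Rightarrow> real" where
  "multichoose n k = int_binom (n + k - 1) k"

(* Matrix indices start at 0, so the exponent m + 2 - p - q of the 1-based
   convention becomes m - p - q; it is an integer, possibly negative. *)
definition Lambda_mat :: "nat \<Rightarrow> int \<Rightarrow> real mat" where
  "Lambda_mat m a = mat (m + 1) (m + 1) (\<lambda>(p, q). multichoose a (int m - int p - int q))"

definition Lambda_prod :: "nat \<Rightarrow> int list \<Rightarrow> real mat" where
  "Lambda_prod m cs = foldr (\<lambda>c M. Lambda_mat m c * M) cs (1\<^sub>m (m + 1))"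

text \<open>
  Complete quotients and partial quotients of a real number, counted from 0. For rational
  \<open>x\<close> they are meaningful only up to the first integral complete quotient.
\<close>

fun cf_tail :: "real \<Rightarrow> nat \<Rightarrow> real" where
  "cf_tail x 0 = x"
| "cf_tail x (Suc n) = 1 / (cf_tail x n - of_int \<lfloor>cf_tail x n\<rfloor>)"

definition cf_coeff :: "real \<Rightarrow> nat \<Rightarrow> int" where
  "cf_coeff x n = \<lfloor>cf_tail x n\<rfloor>"

text \<open>
  The finite expansion of a rational number. Of the two expansions \<open>[\<dots>, c, 1]\<close> and
  \<open>[\<dots>, c + 1]\<close> this is the second one; both give the same first column of the
  product of the matrices \<open>Lambda_mat m c\<close>.
\<close>

definition cf_list :: "real \<Rightarrow> int list" where
  "cf_list x = map (cf_coeff x) [0..<Suc (LEAST n. cf_tail x n \<in> \<int>)]"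

fun cf_value :: "int list \<Rightarrow> real" where
  "cf_value [] = 0"
| "cf_value [c] = of_int c"
| "cf_value (c # cs) = of_int c + 1 / cf_value cs"

definition cf_convergent :: "real \<Rightarrow> nat \<Rightarrow> real" where
  "cf_convergent x n = cf_value (map (cf_coeff x) [0..<Suc n])"

(* The first column of X, divided by its last entry, lists r_m, ..., r_0 from top to bottom,
   so r_i is found in row m - i. *)
definition r_rat :: "nat \<Rightarrow> nat \<Rightarrow> real \<Rightarrow> real" where
  "r_rat i m x = (let X = Lambda_prod m (cf_list x) in X $$ (m - i, 0) / X $$ (m, 0))"

definition r_num :: "nat \<Rightarrow> nat \<Rightarrow> real \<Rightarrow> real" where
  "r_num i m x = (if x \<in> \<rat> then r_rat i m x else lim (\<lambda>n. r_rat i m (cf_convergent x n)))"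

end

theory Submission
  imports Defs
begin

text \<open>
  Write \<open>R x\<close> for the vector \<open>(r_0 x, \<dots>, r_m x)\<close>. With the rows read from bottom to top, the
  matrix for \<open>c\<close> reverses a vector and then multiplies its generating polynomial by
  \<open>(1 - t)\<close> to the power \<open>- c\<close>, modulo the power \<open>m + 1\<close> of \<open>t\<close>. After normalization to first
  entry 1 this gives the recursion \<open>R x = cf_step m c (R y)\<close> for \<open>x = c + 1 / y\<close> with \<open>y > 1\<close>,
  and \<open>R c = (multichoose c i)\<^sub>i\<close> for an integer \<open>c\<close>. Multiplication by the inverse of
  \<open>1 - t\<close> takes partial sums, so \<open>R y\<close> is nondecreasing with first entry 1 for every
  \<open>y \<ge> 1\<close>. Such vectors are called admissible.

  Away from the integers \<open>\<lfloor>x\<rfloor>\<close> is locally constant, so by the recursion continuity at \<open>x\<close>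
  follows from continuity at \<open>1 / frac x\<close>. Three cases remain.

  Integers. As \<open>x\<close> decreases to \<open>c\<close>, the argument \<open>y\<close> tends to infinity; \<open>r_i y\<close> grows like the
  power \<open>i\<close> of \<open>y\<close>, so \<open>R y\<close> divided by its last entry tends to the last unit vector, and the
  recursion gives the limit \<open>multichoose c i\<close>. As \<open>x\<close> increases to \<open>c\<close>, the first partial
  quotient is \<open>c - 1\<close> and \<open>y\<close> decreases to 1, where the limit just found is the vector of ones;
  the recursion turns it into the sum of \<open>multichoose (c - 1) q\<close> over \<open>q \<le> i\<close>, which is again
  \<open>multichoose c i\<close> (\<open>tendsto_at_right_of_int\<close>, \<open>tendsto_at_left_of_int\<close>).

  Rational numbers. The expansion is finite, so finitely many uses of the recursion lead to an
  integer.

  Irrational numbers. Two consecutive steps with partial quotients \<open>a, b \<ge> 1\<close> apply a positive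
  matrix whose entries agree with those of a rank one matrix up to a factor between 1 and
  \<open>m + 1\<close>, whatever \<open>a\<close> and \<open>b\<close> are (\<open>Lambda_op_twice_bounds\<close>). As in Birkhoff's
  contraction theorem, such a matrix shrinks the projective distance of positive vectors, measured
  as in \<open>close_rays\<close>, by the factor \<open>1 - 1 / (m + 1)\<close> (\<open>close_rays_contract\<close>) and brings all of them within a fixed
  distance of each other (\<open>close_rays_Lambda_op_twice\<close>). Hence numbers above 1 that share many
  partial quotients have nearly equal vectors. For the convergents of one irrational number this
  makes the defining limit exist, and for the numbers in a small neighbourhood of an irrational
  number it is continuity.
\<close>

section \<open>Multiset coefficients\<close>

lemma multichoose_neg: "k < 0 \<Longrightarrow> multichoose a k = 0"
  by (simp add: multichoose_def int_binom_def)

lemma multichoose_nat: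
  "multichoose a (int k) = (of_int a + of_nat k - 1) gchoose k"
  by (simp add: multichoose_def int_binom_def)

lemma multichoose_0 [simp]: "multichoose a 0 = 1"
  by (simp add: multichoose_def int_binom_def)

lemma multichoose_nonneg:
  assumes "a \<ge> 0" shows "multichoose a (int k) \<ge> 0"
proof (cases k)
  case (Suc n)
  have "of_int a + of_nat k - 1 = (of_nat (nat a + n) :: real)"
    using assms Suc by simp
  then show ?thesis
    by (metis multichoose_nat binomial_gbinomial of_nat_0_le_iff)
qed simp

lemma multichoose_Suc:
  "multichoose (a + 1) (int (Suc k)) = multichoose (a + 1) (int k) + multichoose a (int (Suc k))"
proof -
  have "of_int (a + 1) + of_nat (Suc k) - 1 = (of_int a + of_nat k :: real) + 1"
    "of_int (a + 1) + of_nat k - 1 = (of_int a + of_nat k :: real)"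
    "of_int a + of_nat (Suc k) - 1 = (of_int a + of_nat k :: real)"
    by simp_all
  then show ?thesis
    unfolding multichoose_nat by (simp only: gbinomial_Suc_Suc)
qed

text \<open>
  The ratio of successive coefficients grows with \<open>a\<close>; this makes the last entry of \<open>R y\<close> dominate
  when \<open>y\<close> is large.
\<close>
lemma multichoose_Suc_mult:
  "of_nat (Suc k) * multichoose a (int (Suc k)) = (of_int a + of_nat k) * multichoose a (int k)"
proof -
  have "of_int a + of_nat (Suc k) - 1 = (of_int a + of_nat k :: real)"
    by simp
  then show ?thesis
    unfolding multichoose_nat by (simp only: gbinomial_absorption)
qed

lemma sum_multichoose:
  "(\<Sum>q\<le>i. multichoose a (int q)) = multichoose (a + 1) (int i)"
proof (induction i)
  case (Suc i)
  then show ?case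
    by (simp only: sum.atMost_Suc multichoose_Suc)
qed simp

lemma multichoose_mono:
  assumes "a \<ge> 1" "j \<le> k"
  shows "multichoose a (int j) \<le> multichoose a (int k)"
proof -
  have "multichoose a (int n) \<le> multichoose a (int (Suc n))" for n
    using multichoose_Suc[of "a - 1" n] multichoose_nonneg[of "a - 1" "Suc n"] assms(1) by simp
  then show ?thesis
    using assms(2) by (rule lift_Suc_mono_le)
qed

lemma multichoose_ge_1:
  assumes "a \<ge> 1" shows "multichoose a (int k) \<ge> 1"
  using multichoose_mono[OF assms, of 0 k] by simp

section \<open>The recursion step on vectors\<close>

text \<open>
  The matrix for \<open>c\<close> acting on vectors whose index \<open>i\<close> counts the rows from bottom to top, so that
  \<open>w i\<close> stands in row \<open>m - i\<close>. A vector is any function, of which only the values on \<open>{..m}\<close> matter.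
\<close>
definition Lambda_op :: "nat \<Rightarrow> int \<Rightarrow> (nat \<Rightarrow> real) \<Rightarrow> nat \<Rightarrow> real" where
  "Lambda_op m c w i = (\<Sum>q\<le>i. multichoose c (int (i - q)) * w (m - q))"

text \<open>
  Since \<open>w m\<close> is the entry at index 0 of the image, the division restores first entry 1.
\<close>
definition cf_step :: "nat \<Rightarrow> int \<Rightarrow> (nat \<Rightarrow> real) \<Rightarrow> nat \<Rightarrow> real" where
  "cf_step m c w i = Lambda_op m c w i / w m"

definition admissible :: "nat \<Rightarrow> (nat \<Rightarrow> real) \<Rightarrow> bool" where
  "admissible m w \<longleftrightarrow> w 0 = 1 \<and> mono_on {..m} w"

lemma admissible_ge_1: "admissible m w \<Longrightarrow> i \<le> m \<Longrightarrow> w i \<ge> 1"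
  unfolding admissible_def mono_on_def by (metis atMost_iff le0)

lemma admissible_pos: "admissible m w \<Longrightarrow> i \<le> m \<Longrightarrow> w i > 0"
  using admissible_ge_1 by fastforce

lemma Lambda_op_0 [simp]: "Lambda_op m c w 0 = w m"
  by (simp add: Lambda_op_def)

lemma Lambda_op_cong: "i \<le> m \<Longrightarrow> (\<And>j. j \<le> m \<Longrightarrow> w j = v j) \<Longrightarrow> Lambda_op m c w i = Lambda_op m c v i"
  by (auto simp: Lambda_op_def intro!: sum.cong)

lemma Lambda_op_scale: "Lambda_op m c (\<lambda>j. r * w j) i = r * Lambda_op m c w i"
  by (simp add: Lambda_op_def sum_distrib_left mult.left_commute)

lemma Lambda_op_add: "Lambda_op m c (\<lambda>j. u j + v j) i = Lambda_op m c u i + Lambda_op m c v i"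
  by (simp add: Lambda_op_def sum.distrib algebra_simps)

text \<open>
  For \<open>c \<ge> 1\<close> the coefficients of the power \<open>- c\<close> of \<open>1 - t\<close> are nonnegative and nondecreasing, and so
  are those of its product with a polynomial that has nonnegative coefficients.
\<close>
lemma Lambda_op_mono_index:
  assumes "c \<ge> 1" "\<And>j. j \<le> m \<Longrightarrow> w j \<ge> 0" "i \<le> k"
  shows "Lambda_op m c w i \<le> Lambda_op m c w k"
proof -
  have "Lambda_op m c w i \<le> (\<Sum>q\<le>i. multichoose c (int (k - q)) * w (m - q))"
    unfolding Lambda_op_def
    by (intro sum_mono mult_right_mono multichoose_mono) (use assms in auto)
  also have "\<dots> \<le> Lambda_op m c w k"
    unfolding Lambda_op_def
    by (intro sum_mono2) (use assms in \<open>auto intro!: mult_nonneg_nonneg multichoose_nonneg simp del: of_nat_diff\<close>)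
  finally show ?thesis .
qed

lemma Lambda_op_nonneg:
  assumes "c \<ge> 1" "\<And>j. j \<le> m \<Longrightarrow> w j \<ge> 0"
  shows "Lambda_op m c w i \<ge> 0"
  using Lambda_op_mono_index[of c m w 0 i] assms(1) assms(2)[of m] assms(2) by fastforce

lemma admissible_cf_step:
  assumes "c \<ge> 1" "admissible m w"
  shows "admissible m (cf_step m c w)"
proof -
  have "w m > 0" "\<And>j. j \<le> m \<Longrightarrow> w j \<ge> 0"
    using admissible_pos[OF assms(2)] by (auto intro: less_imp_le)
  then show ?thesis
    unfolding admissible_def cf_step_def
    by (auto simp: mono_on_def divide_le_cancel intro!: Lambda_op_mono_index assms(1))
qed

text \<open>
  The coefficients themselves satisfy such an inequality between neighbouring indices. Convolution
  with a nonnegative vector preserves it, and monotonicity passes from index \<open>j + 1\<close> to \<open>m\<close>.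
\<close>
lemma Lambda_op_growth:
  assumes "c \<ge> 1" "\<And>j. j \<le> m \<Longrightarrow> w j \<ge> 0" "j < m"
  shows "of_int c * Lambda_op m c w j \<le> of_nat m * Lambda_op m c w m"
proof -
  have grow: "of_int c * multichoose c (int k) \<le> of_nat m * multichoose c (int (Suc k))"
    if "k < m" for k
  proof -
    have "of_int c * multichoose c (int k) \<le> of_nat (Suc k) * multichoose c (int (Suc k))"
      unfolding multichoose_Suc_mult
      using assms(1) by (intro mult_right_mono multichoose_nonneg) auto
    also have "\<dots> \<le> of_nat m * multichoose c (int (Suc k))"
      using assms(1) that by (intro mult_right_mono multichoose_nonneg) auto
    finally show ?thesis .
  qed
  have "of_int c * Lambda_op m c w j = (\<Sum>q\<le>j. of_int c * multichoose c (int (j - q)) * w (m - q))"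
    by (simp add: Lambda_op_def sum_distrib_left mult.assoc)
  also have "\<dots> \<le> (\<Sum>q\<le>j. of_nat m * multichoose c (int (Suc j - q)) * w (m - q))"
    by (intro sum_mono mult_right_mono)
       (use assms grow in \<open>auto simp: Suc_diff_le simp del: of_nat_Suc of_nat_diff\<close>)
  also have "\<dots> \<le> of_nat m * Lambda_op m c w (Suc j)"
    using assms(2)[of "m - Suc j"] assms(3)
    by (simp add: Lambda_op_def sum_distrib_left mult.assoc algebra_simps)
  also have "\<dots> \<le> of_nat m * Lambda_op m c w m"
    using assms by (intro mult_left_mono Lambda_op_mono_index) auto
  finally show ?thesis .
qed

section \<open>Projective contraction\<close>

text \<open>
  For positive vectors the smallest such \<open>d\<close> is the exponential of Hilbert's projective distance,
  minus 1. In this form the contraction estimate is linear in \<open>d\<close>.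
\<close>
definition close_rays :: "nat \<Rightarrow> real \<Rightarrow> (nat \<Rightarrow> real) \<Rightarrow> (nat \<Rightarrow> real) \<Rightarrow> bool" where
  "close_rays m d u v \<longleftrightarrow> (\<exists>l>0. \<forall>i\<le>m. l * v i \<le> u i \<and> u i \<le> l * (1 + d) * v i)"

lemma close_rays_scale:
  assumes "close_rays m d u v" "r > 0" "s > 0"
  shows "close_rays m d (\<lambda>i. u i / r) (\<lambda>i. v i / s)"
proof -
  obtain l where l: "l > 0" "\<And>i. i \<le> m \<Longrightarrow> l * v i \<le> u i \<and> u i \<le> l * (1 + d) * v i"
    using assms(1) unfolding close_rays_def by blast
  have "l * s / r > 0" using l assms by simp
  moreover have "l * s / r * (v i / s) \<le> u i / r \<and> u i / r \<le> l * s / r * (1 + d) * (v i / s)"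
    if "i \<le> m" for i
    using l(2)[OF that] assms by (simp add: divide_right_mono)
  ultimately show ?thesis unfolding close_rays_def by blast
qed

text \<open>
  The common entry 1 at index 0 forces \<open>l \<le> 1 \<le> l * (1 + d)\<close>, so projective closeness bounds the
  entries themselves.
\<close>
lemma close_rays_normalized:
  assumes "close_rays m d u v" "d \<ge> 0" "admissible m u" "admissible m v" "i \<le> m"
  shows "\<bar>u i - v i\<bar> \<le> d * v i"
proof -
  obtain l where l: "l > 0" "\<And>i. i \<le> m \<Longrightarrow> l * v i \<le> u i \<and> u i \<le> l * (1 + d) * v i"
    using assms(1) unfolding close_rays_def by blast
  have l1: "l \<le> 1" "1 \<le> l * (1 + d)"
    using l(2)[of 0] assms(3,4) by (auto simp: admissible_def)
  have "l * d \<le> 1 * d" using l1 assms(2) by (intro mult_right_mono) auto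
  then have l2: "1 - l \<le> d" "l * (1 + d) \<le> 1 + d" using l1 by (auto simp: algebra_simps)
  have v: "v i \<ge> 0" using admissible_pos[OF assms(4,5)] by simp
  have "u i \<le> (1 + d) * v i"
    using l(2)[OF assms(5)] mult_right_mono[OF l2(2) v] by linarith
  moreover have "(1 - d) * v i \<le> u i"
    using l(2)[OF assms(5)] mult_right_mono[of "1 - d" l "v i"] l2 v by linarith
  ultimately show ?thesis by (simp add: algebra_simps abs_le_iff)
qed

text \<open>
  The term with index 0 of the outer sum is \<open>multichoose a i * Lambda_op m b w m\<close>. By monotonicity it
  is the largest of at most \<open>m + 1\<close> terms. The bounding expression is a vector depending only on \<open>a\<close>
  times a linear functional of \<open>w\<close> depending only on \<open>b\<close>, and the factor \<open>m + 1\<close> depends on neither.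
\<close>
lemma Lambda_op_twice_bounds:
  assumes "a \<ge> 1" "b \<ge> 1" "\<And>j. j \<le> m \<Longrightarrow> w j \<ge> 0" "i \<le> m"
  shows "multichoose a (int i) * Lambda_op m b w m \<le> Lambda_op m a (Lambda_op m b w) i"
    and "Lambda_op m a (Lambda_op m b w) i \<le> of_nat (m + 1) * (multichoose a (int i) * Lambda_op m b w m)"
proof -
  have nn: "Lambda_op m b w j \<ge> 0" for j using assms by (intro Lambda_op_nonneg) auto
  have mn: "multichoose a (int j) \<ge> 0" for j using assms by (intro multichoose_nonneg) auto
  have "multichoose a (int (i - 0)) * Lambda_op m b w (m - 0) \<le> Lambda_op m a (Lambda_op m b w) i"
    unfolding Lambda_op_def[of m a]
    by (rule member_le_sum) (use nn mn in \<open>auto simp del: of_nat_diff\<close>)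
  then show "multichoose a (int i) * Lambda_op m b w m \<le> Lambda_op m a (Lambda_op m b w) i" by simp
  have "Lambda_op m a (Lambda_op m b w) i \<le> (\<Sum>q\<le>i. multichoose a (int i) * Lambda_op m b w m)"
    unfolding Lambda_op_def[of m a]
    by (intro sum_mono mult_mono multichoose_mono Lambda_op_mono_index) (use assms nn mn in \<open>auto simp del: of_nat_diff\<close>)
  also have "\<dots> = of_nat (i + 1) * (multichoose a (int i) * Lambda_op m b w m)" by simp
  also have "\<dots> \<le> of_nat (m + 1) * (multichoose a (int i) * Lambda_op m b w m)"
    using assms nn mn by (intro mult_right_mono) auto
  finally show "Lambda_op m a (Lambda_op m b w) i \<le> of_nat (m + 1) * (multichoose a (int i) * Lambda_op m b w m)" .
qed

lemma Lambda_op_pos: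
  assumes "b \<ge> 1" "\<And>j. j \<le> m \<Longrightarrow> w j > 0"
  shows "Lambda_op m b w i > 0"
  using Lambda_op_mono_index[of b m w 0 i] assms by (fastforce intro: less_imp_le)

text \<open>
  Both images lie between a multiple of one fixed vector and \<open>m + 1\<close> times that multiple, which bounds
  their projective distance uniformly in \<open>u\<close>, \<open>v\<close>, \<open>a\<close> and \<open>b\<close>.
\<close>
lemma close_rays_Lambda_op_twice:
  assumes "a \<ge> 1" "b \<ge> 1" "\<And>j. j \<le> m \<Longrightarrow> u j > 0" "\<And>j. j \<le> m \<Longrightarrow> v j > 0"
  shows "close_rays m (of_nat (m + 1) ^ 2 - 1) (Lambda_op m a (Lambda_op m b u)) (Lambda_op m a (Lambda_op m b v))"
proof -
  define K where "K = (of_nat (m + 1) :: real)"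
  have K: "K \<ge> 1" by (simp add: K_def)
  define s t where "s = Lambda_op m b u m" and "t = Lambda_op m b v m"
  have pos: "s > 0" "t > 0" unfolding s_def t_def using assms by (auto intro!: Lambda_op_pos)
  have nn: "u j \<ge> 0" "v j \<ge> 0" if "j \<le> m" for j
    using assms(3,4)[OF that] by auto
  have "s / (K * t) * Lambda_op m a (Lambda_op m b v) i \<le> Lambda_op m a (Lambda_op m b u) i \<and>
    Lambda_op m a (Lambda_op m b u) i \<le> s / (K * t) * (1 + (K\<^sup>2 - 1)) * Lambda_op m a (Lambda_op m b v) i"
    if i: "i \<le> m" for i
  proof -
    define e where "e = multichoose a (int i)"
    note bu = Lambda_op_twice_bounds[of a b m u, OF assms(1,2) nn(1) i, folded K_def s_def e_def]
    note bv = Lambda_op_twice_bounds[of a b m v, OF assms(1,2) nn(2) i, folded K_def t_def e_def]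
    have "s / (K * t) * Lambda_op m a (Lambda_op m b v) i \<le> s / (K * t) * (K * (e * t))"
      using bv pos K by (intro mult_left_mono) auto
    also have "\<dots> = e * s" using pos K by simp
    finally have 1: "s / (K * t) * Lambda_op m a (Lambda_op m b v) i \<le> Lambda_op m a (Lambda_op m b u) i"
      using bu by simp
    have "K * (e * s) = s / (K * t) * K\<^sup>2 * (e * t)"
      using pos K by (simp add: power2_eq_square)
    also have "\<dots> \<le> s / (K * t) * K\<^sup>2 * Lambda_op m a (Lambda_op m b v) i"
      using bv pos K by (intro mult_left_mono) auto
    finally show ?thesis using 1 bu by simp
  qed
  moreover have "s / (K * t) > 0" using pos K by simp
  ultimately show ?thesis unfolding close_rays_def K_def by blast
qed

text \<open>
  Let \<open>l * v \<le> u \<le> l * (1 + d) * v\<close> and let \<open>B\<close> be the composition of the two operators. The differences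
  \<open>lo = u - l * v\<close> and \<open>hi = l * (1 + d) * v - u\<close> are nonnegative, so the rank one bounds give
  \<open>B lo \<ge> p * B v\<close> and \<open>B hi \<ge> q * B v\<close> with \<open>p\<close> and \<open>q\<close> proportional to one functional of \<open>lo\<close> and
  \<open>hi\<close>. Since \<open>lo + hi = l * d * v\<close>, the sum \<open>p + q\<close> is the fraction \<open>1 / (m + 1)\<close> of the width \<open>l * d\<close>
  of the interval of admitted ratios, and the two bounds for \<open>B u\<close> move towards each other by that amount.
\<close>
lemma close_rays_contract:
  assumes "a \<ge> 1" "b \<ge> 1" "\<And>j. j \<le> m \<Longrightarrow> v j > 0" "d \<ge> 0" "close_rays m d u v"
  shows "close_rays m ((1 - 1 / of_nat (m + 1)) * d) (Lambda_op m a (Lambda_op m b u)) (Lambda_op m a (Lambda_op m b v))"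
proof -
  define K where "K = (of_nat (m + 1) :: real)"
  have K: "K \<ge> 1" by (simp add: K_def)
  define B where "B = (\<lambda>w. Lambda_op m a (Lambda_op m b w))"
  define S where "S = (\<lambda>w. Lambda_op m b w m)"
  have B_lin: "B (\<lambda>j. r * x j + q * y j) i = r * B x i + q * B y i" for r q x y i
  proof -
    have "Lambda_op m b (\<lambda>j. r * x j + q * y j) = (\<lambda>j. r * Lambda_op m b x j + q * Lambda_op m b y j)"
      by (rule ext) (simp add: Lambda_op_add Lambda_op_scale)
    then show ?thesis unfolding B_def by (simp only: Lambda_op_add Lambda_op_scale)
  qed
  have S_lin: "S (\<lambda>j. r * x j + q * y j) = r * S x + q * S y" for r q x y
    unfolding S_def by (simp add: Lambda_op_add Lambda_op_scale)
  obtain l where l: "l > 0" "\<And>i. i \<le> m \<Longrightarrow> l * v i \<le> u i \<and> u i \<le> l * (1 + d) * v i"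
    using assms(5) unfolding close_rays_def by blast
  have v0: "v j \<ge> 0" if "j \<le> m" for j
    using assms(3)[OF that] by simp
  have Sv: "S v > 0" unfolding S_def using assms by (auto intro!: Lambda_op_pos)
  have bound: "S w / (K * S v) * B v i \<le> B w i"
    if w: "\<And>j. j \<le> m \<Longrightarrow> w j \<ge> 0" and i: "i \<le> m" for w i
  proof -
    have "S w \<ge> 0" unfolding S_def using assms w by (intro Lambda_op_nonneg) auto
    then have "S w / (K * S v) * B v i \<le> S w / (K * S v) * (K * (multichoose a (int i) * S v))"
      using Lambda_op_twice_bounds(2)[OF assms(1,2) v0 i] Sv K
      unfolding B_def S_def K_def by (intro mult_left_mono) auto
    also have "\<dots> = multichoose a (int i) * S w" using Sv K by simp
    also have "\<dots> \<le> B w i"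
      using Lambda_op_twice_bounds(1)[OF assms(1,2) w i] unfolding B_def S_def by simp
    finally show ?thesis .
  qed
  define lo where "lo = (\<lambda>j. 1 * u j + (- l) * v j)"
  define hi where "hi = (\<lambda>j. (l * (1 + d)) * v j + (- 1) * u j)"
  have nn: "lo j \<ge> 0" "hi j \<ge> 0" if "j \<le> m" for j
    using l(2)[OF that] by (auto simp: lo_def hi_def)
  define p q where "p = S lo / (K * S v)" and "q = S hi / (K * S v)"
  have p0: "p \<ge> 0"
    using nn(1) Sv K assms(1,2) unfolding p_def S_def by (auto intro!: divide_nonneg_pos Lambda_op_nonneg mult_pos_pos)
  have pq: "p + q = l * d / K"
    unfolding p_def q_def lo_def hi_def S_lin using Sv K by (simp add: field_simps)
  define d' where "d' = (1 - 1 / K) * d"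
  have d'0: "d' \<ge> 0" unfolding d'_def using K assms(4) by simp
  \<comment> \<open>The width contracts absolutely; since the lower bound only grows, so does the relative width.\<close>
  have "l * (1 + d) - q = (l + p) + l * d'"
    using pq unfolding d'_def by (simp add: algebra_simps)
  also have "\<dots> \<le> (l + p) * (1 + d')"
    using p0 d'0 by (simp add: algebra_simps)
  finally have key: "l * (1 + d) - q \<le> (l + p) * (1 + d')" .
  have "(l + p) * B v i \<le> B u i \<and> B u i \<le> (l + p) * (1 + d') * B v i" if i: "i \<le> m" for i
  proof
    have "p * B v i \<le> B u i - l * B v i"
      using bound[OF nn(1) i] unfolding p_def lo_def B_lin by simp
    then show "(l + p) * B v i \<le> B u i" by (simp add: algebra_simps)
    have "q * B v i \<le> l * (1 + d) * B v i - B u i"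
      using bound[OF nn(2) i] unfolding q_def hi_def B_lin by simp
    then have "B u i \<le> (l * (1 + d) - q) * B v i" by (simp add: algebra_simps)
    also have "\<dots> \<le> (l + p) * (1 + d') * B v i"
    proof (rule mult_right_mono[OF key])
      show "0 \<le> B v i"
        unfolding B_def by (intro Lambda_op_nonneg assms(1,2) v0)
    qed
    finally show "B u i \<le> (l + p) * (1 + d') * B v i" .
  qed
  moreover have "l + p > 0" using l p0 by simp
  ultimately show ?thesis unfolding close_rays_def B_def d'_def K_def by blast
qed

lemma cf_step_twice:
  assumes "w m > 0"
  shows "cf_step m a (cf_step m b w) = (\<lambda>i. Lambda_op m a (Lambda_op m b w) i / Lambda_op m b w m)"
proof
  fix i
  have "cf_step m b w = (\<lambda>j. (1 / w m) * Lambda_op m b w j)" by (auto simp: cf_step_def)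
  then show "cf_step m a (cf_step m b w) i = Lambda_op m a (Lambda_op m b w) i / Lambda_op m b w m"
    unfolding cf_step_def[of m a] using assms by (simp only: Lambda_op_scale) simp
qed

lemma close_rays_cf_step_twice:
  assumes "a \<ge> 1" "b \<ge> 1" "admissible m u" "admissible m v"
  shows "close_rays m (of_nat (m + 1) ^ 2 - 1) (cf_step m a (cf_step m b u)) (cf_step m a (cf_step m b v))"
    and "\<lbrakk>d \<ge> 0; close_rays m d u v\<rbrakk> \<Longrightarrow>
      close_rays m ((1 - 1 / of_nat (m + 1)) * d) (cf_step m a (cf_step m b u)) (cf_step m a (cf_step m b v))"
proof -
  note pos = admissible_pos[OF assms(3)] admissible_pos[OF assms(4)]
  note eq = cf_step_twice[of u, OF pos(1)[OF order_refl]] cf_step_twice[of v, OF pos(2)[OF order_refl]]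
  have P: "Lambda_op m b u m > 0" "Lambda_op m b v m > 0" using assms pos by (auto intro!: Lambda_op_pos)
  show "close_rays m (of_nat (m + 1) ^ 2 - 1) (cf_step m a (cf_step m b u)) (cf_step m a (cf_step m b v))"
    unfolding eq by (intro close_rays_scale close_rays_Lambda_op_twice P assms pos)
  show "close_rays m ((1 - 1 / of_nat (m + 1)) * d) (cf_step m a (cf_step m b u)) (cf_step m a (cf_step m b v))"
    if "d \<ge> 0" "close_rays m d u v"
    unfolding eq by (intro close_rays_scale close_rays_contract P assms pos that)
qed

text \<open>
  The distance that remains after \<open>N + 1\<close> pairs of steps: the first pair gives a bound for arbitrary
  admissible vectors, and each later pair contracts it.
\<close>
definition gap :: "nat \<Rightarrow> nat \<Rightarrow> real" where
  "gap m N = (1 - 1 / of_nat (m + 1)) ^ N * (of_nat (m + 1) ^ 2 - 1)"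

lemma gap_nonneg: "gap m N \<ge> 0"
  unfolding gap_def by (intro mult_nonneg_nonneg zero_le_power) (auto simp: field_simps)

lemma gap_less:
  assumes "e > 0"
  obtains N where "gap m N * C < e"
proof -
  have "(\<lambda>N. (1 - 1 / of_nat (m + 1) :: real) ^ N) \<longlonglongrightarrow> 0"
    by (rule LIMSEQ_power_zero) (simp add: abs_less_iff field_simps)
  then have "(\<lambda>N. gap m N * C) \<longlonglongrightarrow> 0 * (of_nat (m + 1) ^ 2 - 1) * C"
    unfolding gap_def by (rule tendsto_mult_right[OF tendsto_mult_right])
  then have "\<forall>\<^sub>F N in sequentially. gap m N * C < e"
    using assms by (intro order_tendstoD(2)) auto
  then show ?thesis using that by (auto simp: eventually_sequentially)
qed

text \<open>
  The disjunction joins the first pair of steps, whose bound is uniform, to the contracting ones, so that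
  inductions on \<open>N\<close> have a single case.
\<close>
lemma close_rays_cf_step_twice_gap:
  assumes "a \<ge> 1" "b \<ge> 1" "admissible m u" "admissible m v"
    "N = 0 \<or> close_rays m (gap m (N - 1)) u v"
  shows "close_rays m (gap m N) (cf_step m a (cf_step m b u)) (cf_step m a (cf_step m b v))"
proof (cases N)
  case 0
  then show ?thesis using close_rays_cf_step_twice(1)[OF assms(1-4)] by (simp add: gap_def)
next
  case (Suc k)
  then show ?thesis
    using close_rays_cf_step_twice(2)[OF assms(1-4) gap_nonneg[of m k]] assms(5)
    by (simp add: gap_def mult.assoc)
qed

lemma tendsto_cf_step:
  assumes "\<And>j. j \<le> m \<Longrightarrow> ((\<lambda>t. w t j) \<longlongrightarrow> v j) F" "v m \<noteq> 0" "i \<le> m"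
  shows "((\<lambda>t. cf_step m c (w t) i) \<longlongrightarrow> cf_step m c v i) F"
  unfolding cf_step_def Lambda_op_def
  by (intro tendsto_intros assms) auto

section \<open>Continued fractions\<close>

lemma cf_tail_Suc_shift: "cf_tail x (Suc n) = cf_tail (1 / frac x) n"
proof (induction n)
  case (Suc n)
  then show ?case
    by (metis cf_tail.simps(2))
qed (simp add: frac_def)

lemma cf_coeff_0 [simp]: "cf_coeff x 0 = \<lfloor>x\<rfloor>"
  by (simp add: cf_coeff_def)

lemma cf_coeff_Suc: "cf_coeff x (Suc n) = cf_coeff (1 / frac x) n"
  unfolding cf_coeff_def cf_tail_Suc_shift ..

lemma map_cf_coeff_Suc:
  "map (cf_coeff x) [0..<Suc (Suc n)] = \<lfloor>x\<rfloor> # map (cf_coeff (1 / frac x)) [0..<Suc n]"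
proof -
  have "map (cf_coeff x) [0..<Suc (Suc n)] = cf_coeff x 0 # map (\<lambda>k. cf_coeff x (Suc k)) [0..<Suc n]"
    by (simp only: upt_conv_Cons[of 0 "Suc (Suc n)"] map_Suc_upt[symmetric] map_map list.map o_def)
  then show ?thesis by (simp only: cf_coeff_0 cf_coeff_Suc)
qed

text \<open>
  The Euclidean algorithm: the tail of \<open>p / q\<close> is \<open>q / (p mod q)\<close>, whose denominator is smaller.
\<close>
lemma cf_terminates:
  assumes "x \<in> \<rat>"
  shows "\<exists>n. cf_tail x n \<in> \<int>"
proof -
  have "\<exists>n. cf_tail (of_int p / of_nat q) n \<in> \<int>" if "q > 0" for p q
    using that
  proof (induction q arbitrary: p rule: less_induct)
    case (less q)
    define x where "x = (of_int p / of_nat q :: real)"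
    define r where "r = p mod int q"
    have r: "0 \<le> r" "r < int q" using less.prems by (auto simp: r_def)
    have "\<lfloor>x\<rfloor> = p div int q" unfolding x_def
      by (metis floor_divide_of_int_eq of_int_of_nat_eq)
    then have fr: "frac x = of_int r / of_nat q"
      using less.prems unfolding frac_def x_def r_def
      by (simp add: minus_div_mult_eq_mod[symmetric] field_simps)
    show ?case
    proof (cases "r = 0")
      case True
      then have "cf_tail x 0 \<in> \<int>" using fr by (simp add: frac_eq_0_iff)
      then show ?thesis unfolding x_def by blast
    next
      case False
      then obtain n where "cf_tail (of_int (int q) / of_nat (nat r)) n \<in> \<int>"
        using less.IH[of "nat r" "int q"] r by (auto simp: nat_less_iff)
      then have "cf_tail x (Suc n) \<in> \<int>"
        unfolding cf_tail_Suc_shift fr using r False by simp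
      then show ?thesis unfolding x_def by blast
    qed
  qed
  moreover obtain p q where "q > (0::int)" "x = of_int p / of_int q"
    using assms by (metis Rats_cases')
  moreover have "of_int q = (of_nat (nat q) :: real)" using \<open>q > 0\<close> by simp
  ultimately show ?thesis by (metis zero_less_nat_eq)
qed

lemma cf_list_of_int: "cf_list (of_int c) = [c]"
proof -
  have "(LEAST n. cf_tail (of_int c) n \<in> \<int>) = 0" by (rule Least_eq_0) simp
  then show ?thesis by (simp add: cf_list_def)
qed

lemma cf_list_Cons:
  assumes "x \<in> \<rat>" "x \<notin> \<int>"
  shows "cf_list x = \<lfloor>x\<rfloor> # cf_list (1 / frac x)"
proof -
  obtain n where "cf_tail x n \<in> \<int>" using cf_terminates[OF assms(1)] by blast
  then have "(LEAST n. cf_tail x n \<in> \<int>) = Suc (LEAST n. cf_tail x (Suc n) \<in> \<int>)"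
    by (rule Least_Suc) (simp add: assms(2))
  then show ?thesis
    unfolding cf_list_def by (simp only: map_cf_coeff_Suc cf_tail_Suc_shift)
qed

section \<open>The vectors of rational numbers\<close>

definition column :: "nat \<Rightarrow> int list \<Rightarrow> nat \<Rightarrow> real" where
  "column m cs i = Lambda_prod m cs $$ (m - i, 0)"

lemma Lambda_prod_carrier: "Lambda_prod m cs \<in> carrier_mat (m + 1) (m + 1)"
  by (induction cs) (auto simp: Lambda_prod_def Lambda_mat_def)

lemma column_Cons:
  assumes "i \<le> m"
  shows "column m (c # cs) i = Lambda_op m c (column m cs) i"
proof -
  let ?M = "Lambda_prod m cs"
  have M: "dim_row ?M = m + 1" "dim_col ?M = m + 1" using Lambda_prod_carrier[of m cs] by auto
  have "column m (c # cs) i = (\<Sum>q<m+1. multichoose c (int m - int (m - i) - int q) * ?M $$ (q, 0))"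
    using M assms
    by (simp add: column_def Lambda_prod_def Lambda_mat_def scalar_prod_def atLeast0LessThan
             del: of_nat_diff sum.lessThan_Suc)
  also have "\<dots> = (\<Sum>q\<le>i. multichoose c (int m - int (m - i) - int q) * ?M $$ (q, 0))"
    using assms by (intro sum.mono_neutral_right) (auto simp: multichoose_neg)
  also have "\<dots> = Lambda_op m c (column m cs) i"
    unfolding Lambda_op_def column_def using assms by (intro sum.cong) auto
  finally show ?thesis .
qed

text \<open>
  The product over the empty list is the identity, whose first column has its entry 1 in the top row,
  at index \<open>m\<close>.
\<close>
lemma column_singleton:
  assumes "i \<le> m"
  shows "column m [c] i = multichoose c (int i)"
proof -
  have "column m [c] i = (\<Sum>q\<le>i. multichoose c (int (i - q)) * column m [] (m - q))"
    using column_Cons[OF assms] by (simp add: Lambda_op_def)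
  also have "\<dots> = (\<Sum>q\<le>i. if q = 0 then multichoose c (int i) else 0)"
    using assms by (intro sum.cong) (auto simp: column_def Lambda_prod_def)
  finally show ?thesis by simp
qed

lemma r_rat_column: "r_rat i m x = column m (cf_list x) i / column m (cf_list x) 0"
  by (simp add: r_rat_def column_def Let_def)

lemma r_rat_of_int:
  assumes "i \<le> m" shows "r_rat i m (of_int c) = multichoose c (int i)"
  using assms by (simp add: r_rat_column cf_list_of_int column_singleton)

lemma r_rat_step_of_pos:
  assumes "x \<in> \<rat>" "x \<notin> \<int>" "i \<le> m" "column m (cf_list (1 / frac x)) 0 > 0"
  shows "r_rat i m x = cf_step m \<lfloor>x\<rfloor> (\<lambda>j. r_rat j m (1 / frac x)) i"
proof -
  let ?v = "column m (cf_list (1 / frac x))"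
  have "Lambda_op m \<lfloor>x\<rfloor> (\<lambda>j. r_rat j m (1 / frac x)) i = Lambda_op m \<lfloor>x\<rfloor> (\<lambda>j. (1 / ?v 0) * ?v j) i"
    by (simp add: r_rat_column)
  also have "\<dots> = (1 / ?v 0) * Lambda_op m \<lfloor>x\<rfloor> ?v i" by (rule Lambda_op_scale)
  finally have *: "Lambda_op m \<lfloor>x\<rfloor> (\<lambda>j. r_rat j m (1 / frac x)) i = (1 / ?v 0) * Lambda_op m \<lfloor>x\<rfloor> ?v i" .
  show ?thesis
    unfolding cf_step_def * unfolding r_rat_column cf_list_Cons[OF assms(1,2)]
    using assms by (simp add: column_Cons)
qed

lemma admissible_multichoose:
  assumes "c \<ge> 1" shows "admissible m (\<lambda>j. multichoose c (int j))"
  using assms by (auto simp: admissible_def mono_on_def intro: multichoose_mono)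

lemma admissible_cong:
  "(\<And>j. j \<le> m \<Longrightarrow> u j = v j) \<Longrightarrow> admissible m u \<longleftrightarrow> admissible m v"
  by (simp add: admissible_def mono_on_def)

lemma inverse_frac_gt_1: "x \<notin> \<int> \<Longrightarrow> 1 / frac x > (1::real)"
  by (simp add: frac_gt_0_iff frac_lt_1)

lemma inverse_frac_Rats: "1 / frac x \<in> \<rat> \<longleftrightarrow> (x::real) \<in> \<rat>"
proof -
  have "x \<in> \<rat>" if "1 / frac x \<in> \<rat>"
  proof -
    have "x = 1 / (1 / frac x) + of_int \<lfloor>x\<rfloor>" by (simp add: frac_def)
    also have "\<dots> \<in> \<rat>" by (intro Rats_add Rats_of_int Rats_divide[OF Rats_1 that])
    finally show ?thesis .
  qed
  moreover have "1 / frac x \<in> \<rat>" if "x \<in> \<rat>"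
    using that unfolding frac_def by (intro Rats_divide Rats_diff) auto
  ultimately show ?thesis by blast
qed

text \<open>
  The normalizing entry must be positive before the recursion for \<open>r_rat\<close> can be used, and its positivity
  for \<open>x\<close> follows from admissibility for \<open>1 / frac x\<close>; hence both are proved in one induction.
\<close>
lemma column_pos_admissible:
  assumes "x \<in> \<rat>" "x \<ge> 1"
  shows "column m (cf_list x) 0 > 0 \<and> admissible m (\<lambda>j. r_rat j m x)"
proof -
  have of_int: "column m (cf_list x) 0 > 0 \<and> admissible m (\<lambda>j. r_rat j m x)"
    if int: "x \<in> \<int>" and ge: "x \<ge> 1" for x
  proof -
    obtain c where c: "x = of_int c" "c \<ge> 1" using int ge by (auto elim: Ints_cases)
    have "admissible m (\<lambda>j. r_rat j m x) \<longleftrightarrow> admissible m (\<lambda>j. multichoose c (int j))"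
      by (rule admissible_cong) (simp add: c r_rat_of_int)
    then show ?thesis
      using c admissible_multichoose[of c m] by (simp add: cf_list_of_int column_singleton)
  qed
  obtain n where "cf_tail x n \<in> \<int>" using cf_terminates[OF assms(1)] by blast
  then show ?thesis using assms
  proof (induction n arbitrary: x)
    case 0
    then show ?case by (simp add: of_int)
  next
    case (Suc n)
    show ?case
    proof (cases "x \<in> \<int>")
      case True
      then show ?thesis using Suc.prems(3) by (rule of_int)
    next
      case False
      define y where "y = 1 / frac x"
      have IH: "column m (cf_list y) 0 > 0" "admissible m (\<lambda>j. r_rat j m y)"
        using Suc.IH[of y] Suc.prems inverse_frac_gt_1[OF False]
        by (auto simp: cf_tail_Suc_shift inverse_frac_Rats y_def simp del: cf_tail.simps(2))
      have "column m (cf_list x) 0 = r_rat m m y * column m (cf_list y) 0"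
        using IH(1) False Suc.prems by (simp add: cf_list_Cons column_Cons r_rat_column y_def)
      then have "column m (cf_list x) 0 > 0"
        using IH admissible_pos[OF IH(2)] by simp
      moreover have "admissible m (\<lambda>j. r_rat j m x) \<longleftrightarrow>
          admissible m (cf_step m \<lfloor>x\<rfloor> (\<lambda>j. r_rat j m y))"
        using r_rat_step_of_pos[OF Suc.prems(2) False] IH(1) unfolding y_def
        by (intro admissible_cong) auto
      moreover have "admissible m (cf_step m \<lfloor>x\<rfloor> (\<lambda>j. r_rat j m y))"
        using Suc.prems IH by (intro admissible_cf_step) (auto simp: le_floor_iff)
      ultimately show ?thesis by blast
    qed
  qed
qed

lemma r_rat_admissible: "x \<in> \<rat> \<Longrightarrow> x \<ge> 1 \<Longrightarrow> admissible m (\<lambda>j. r_rat j m x)"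
  using column_pos_admissible by blast

lemma r_rat_step:
  assumes "x \<in> \<rat>" "x \<notin> \<int>" "i \<le> m"
  shows "r_rat i m x = cf_step m \<lfloor>x\<rfloor> (\<lambda>j. r_rat j m (1 / frac x)) i"
  using column_pos_admissible[of "1 / frac x" m] inverse_frac_gt_1[OF assms(2)] assms
  by (intro r_rat_step_of_pos) (auto simp: inverse_frac_Rats)

text \<open>
  The vector of the number 1 consists of ones, so the step takes partial sums of \<open>multichoose c\<close>. This is
  the agreement of the expansions \<open>[\<dots>, c, 1]\<close> and \<open>[\<dots>, c + 1]\<close>.
\<close>
lemma cf_step_multichoose_1:
  assumes "i \<le> m"
  shows "cf_step m c (\<lambda>j. multichoose 1 (int j)) i = multichoose (c + 1) (int i)"
proof -
  have one: "multichoose 1 (int k) = 1" for k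
    unfolding multichoose_nat by (simp add: binomial_gbinomial[symmetric])
  have "cf_step m c (\<lambda>j. multichoose 1 (int j)) i = (\<Sum>q\<le>i. multichoose c (int (i - q)))"
    unfolding cf_step_def Lambda_op_def by (simp only: one) simp
  also have "\<dots> = (\<Sum>q\<le>i. multichoose c (int q))"
    by (rule sum.reindex_bij_witness[of _ "\<lambda>q. i - q" "\<lambda>q. i - q"]) auto
  finally show ?thesis by (simp add: sum_multichoose)
qed

lemma cf_step_cong:
  "i \<le> m \<Longrightarrow> (\<And>j. j \<le> m \<Longrightarrow> w j = v j) \<Longrightarrow> cf_step m c w i = cf_step m c v i"
  by (simp add: cf_step_def Lambda_op_cong[of i m w v])

text \<open>
  The case \<open>y = 1\<close> is included because truncating an expansion can produce a last partial quotient 1, as in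
  the convergents below.
\<close>
lemma r_rat_add_inverse:
  assumes "y \<in> \<rat>" "y \<ge> 1" "i \<le> m"
  shows "r_rat i m (of_int c + 1 / y) = cf_step m c (\<lambda>j. r_rat j m y) i"
proof (cases "y = 1")
  case True
  have "cf_step m c (\<lambda>j. r_rat j m y) i = cf_step m c (\<lambda>j. multichoose 1 (int j)) i"
    using r_rat_of_int[of _ m 1] True assms(3) by (intro cf_step_cong) auto
  also have "\<dots> = r_rat i m (of_int (c + 1))"
    using assms(3) by (simp only: cf_step_multichoose_1 r_rat_of_int)
  finally show ?thesis using True by simp
next
  case False
  then have y: "0 < 1 / y" "1 / y < 1" using assms by auto
  have fl: "\<lfloor>of_int c + 1 / y\<rfloor> = c" using y by (simp add: floor_unique)
  then have fr: "frac (of_int c + 1 / y) = 1 / y" by (simp add: frac_def)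
  then have "of_int c + 1 / y \<notin> \<int>" using y by (metis frac_eq_0_iff less_irrefl)
  moreover have "of_int c + 1 / y \<in> \<rat>" using assms by simp
  ultimately show ?thesis using r_rat_step assms(3) fl fr by simp
qed

section \<open>Convergents of irrational numbers\<close>

lemma cf_convergent_Suc:
  "cf_convergent x (Suc n) = of_int \<lfloor>x\<rfloor> + 1 / cf_convergent (1 / frac x) n"
proof -
  have "cf_value (c # cs) = of_int c + 1 / cf_value cs" if "cs \<noteq> []" for c cs
    using that by (cases cs) auto
  then show ?thesis
    unfolding cf_convergent_def map_cf_coeff_Suc by simp
qed

lemma cf_convergent_0 [simp]: "cf_convergent x 0 = of_int \<lfloor>x\<rfloor>"
  by (simp add: cf_convergent_def)

lemma cf_convergent_Rats: "cf_convergent x n \<in> \<rat>"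
  by (induction n arbitrary: x) (auto simp: cf_convergent_Suc)

lemma inverse_frac_ge_1: "x \<notin> \<rat> \<Longrightarrow> 1 / frac x \<ge> (1::real)"
  using inverse_frac_gt_1 by (metis Ints_subset_Rats less_imp_le subsetD)

lemma cf_convergent_ge_1:
  assumes "x \<notin> \<rat>" "x \<ge> 1"
  shows "cf_convergent x n \<ge> 1"
proof (cases n)
  case (Suc k)
  have "cf_convergent y k \<ge> 0" if "y \<notin> \<rat>" "y \<ge> 0" for y k
    using that
  proof (induction k arbitrary: y)
    case (Suc k)
    then show ?case
      using inverse_frac_ge_1[of y] by (auto simp: cf_convergent_Suc inverse_frac_Rats)
  qed auto
  then have "cf_convergent (1 / frac x) k \<ge> 0"
    using assms inverse_frac_ge_1[of x] by (simp add: inverse_frac_Rats)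
  moreover have "real_of_int \<lfloor>x\<rfloor> \<ge> 1" using assms by simp
  ultimately show ?thesis using Suc by (simp add: cf_convergent_Suc add_increasing2)
qed (use assms in auto)

lemma r_rat_convergent_Suc:
  assumes "x \<notin> \<rat>" "i \<le> m"
  shows "r_rat i m (cf_convergent x (Suc n)) =
    cf_step m \<lfloor>x\<rfloor> (\<lambda>j. r_rat j m (cf_convergent (1 / frac x) n)) i"
  unfolding cf_convergent_Suc using assms
  by (intro r_rat_add_inverse cf_convergent_Rats cf_convergent_ge_1)
     (auto simp: inverse_frac_Rats inverse_frac_ge_1)

lemma r_rat_convergent_Suc_Suc:
  assumes "x \<notin> \<rat>" "i \<le> m"
  shows "r_rat i m (cf_convergent x (Suc (Suc n))) =
    cf_step m \<lfloor>x\<rfloor> (cf_step m \<lfloor>1 / frac x\<rfloor>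
      (\<lambda>j. r_rat j m (cf_convergent (1 / frac (1 / frac x)) n))) i"
  unfolding r_rat_convergent_Suc[OF assms]
  by (intro cf_step_cong r_rat_convergent_Suc) (use assms in \<open>auto simp: inverse_frac_Rats\<close>)

text \<open>
  After \<open>2 * N + 2\<close> partial quotients, which are common to both convergents, the remaining expansions
  have admissible vectors.
\<close>
lemma close_convergents:
  assumes "x \<notin> \<rat>" "x \<ge> 1" "n \<ge> 2 * N + 2" "n' \<ge> 2 * N + 2"
  shows "close_rays m (gap m N) (\<lambda>j. r_rat j m (cf_convergent x n)) (\<lambda>j. r_rat j m (cf_convergent x n'))"
  using assms
proof (induction N arbitrary: x n n' rule: less_induct)
  case (less N x n n')
  define k k' where "k = n - 2" and "k' = n' - 2"
  have k: "n = Suc (Suc k)" "n' = Suc (Suc k')" "k \<ge> 2 * N" "k' \<ge> 2 * N"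
    using less.prems(3,4) unfolding k_def k'_def by linarith+
  define y z where "y = 1 / frac x" and "z = 1 / frac y"
  have irr: "y \<notin> \<rat>" "z \<notin> \<rat>" using less.prems by (auto simp: y_def z_def inverse_frac_Rats)
  have y: "y \<ge> 1" unfolding y_def by (rule inverse_frac_ge_1[OF less.prems(1)])
  have z: "z \<ge> 1" unfolding z_def by (rule inverse_frac_ge_1[OF irr(1)])
  have fl: "\<lfloor>x\<rfloor> \<ge> 1" "\<lfloor>y\<rfloor> \<ge> 1" using less.prems y by (simp_all add: le_floor_iff)
  let ?w = "\<lambda>k j. r_rat j m (cf_convergent z k)"
  let ?S = "\<lambda>k. cf_step m \<lfloor>x\<rfloor> (cf_step m \<lfloor>y\<rfloor> (?w k))"
  have "N = 0 \<or> close_rays m (gap m (N - 1)) (?w k) (?w k')"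
  proof (cases "N = 0")
    case False
    then have "close_rays m (gap m (N - 1)) (?w k) (?w k')"
      using k by (intro less.IH irr z) auto
    then show ?thesis ..
  qed simp
  then have "close_rays m (gap m N) (?S k) (?S k')"
    by (intro close_rays_cf_step_twice_gap r_rat_admissible cf_convergent_Rats cf_convergent_ge_1
          fl irr z)
  moreover have "r_rat i m (cf_convergent x (Suc (Suc l))) = ?S l i" if "i \<le> m" for i l
    unfolding y_def z_def by (rule r_rat_convergent_Suc_Suc[OF less.prems(1) that])
  ultimately show ?case
    unfolding k close_rays_def by auto
qed

text \<open>
  The estimate for two convergents is relative to one of them. The case \<open>N = 0\<close>, compared with the
  convergent of index 2, bounds all later ones by \<open>C\<close> and makes the estimate absolute.
\<close>
lemma convergent_r_rat_ge_1:
  assumes "x \<notin> \<rat>" "x \<ge> 1" "i \<le> m"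
  shows "convergent (\<lambda>n. r_rat i m (cf_convergent x n))"
proof -
  let ?f = "\<lambda>n. r_rat i m (cf_convergent x n)"
  have adm: "admissible m (\<lambda>j. r_rat j m (cf_convergent x n))" for n
    using assms by (intro r_rat_admissible cf_convergent_Rats cf_convergent_ge_1)
  have near: "\<bar>?f n - ?f k\<bar> \<le> gap m N * ?f k" if "n \<ge> 2 * N + 2" "k \<ge> 2 * N + 2" for n k N
    using close_rays_normalized[OF close_convergents[OF assms(1,2) that] gap_nonneg adm adm assms(3)] .
  define C where "C = (1 + gap m 0) * ?f 2"
  have C: "?f k \<le> C" if "k \<ge> 2" for k
    using near[of 0 k 2] that by (simp add: C_def algebra_simps)
  have "Cauchy ?f"
  proof (rule CauchyI)
    fix e :: real assume "e > 0"
    then obtain N where N: "gap m N * C < e" by (rule gap_less)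
    have "norm (?f n - ?f k) < e" if "n \<ge> 2 * N + 2" "k \<ge> 2 * N + 2" for n k
      using near[OF that] mult_left_mono[OF C[of k] gap_nonneg[of m N]] that N by simp
    then show "\<exists>M. \<forall>n\<ge>M. \<forall>k\<ge>M. norm (?f n - ?f k) < e" by blast
  qed
  then show ?thesis by (simp add: Cauchy_convergent_iff)
qed

section \<open>The recursion for real numbers\<close>

abbreviation r_vec :: "nat \<Rightarrow> real \<Rightarrow> nat \<Rightarrow> real" where
  "r_vec m x \<equiv> (\<lambda>j. r_num j m x)"

lemma r_num_limit_ge_1:
  assumes "x \<notin> \<rat>" "x \<ge> 1" "i \<le> m"
  shows "(\<lambda>n. r_rat i m (cf_convergent x n)) \<longlonglongrightarrow> r_num i m x"
  using convergent_r_rat_ge_1[OF assms] assms(1) by (simp add: r_num_def convergent_LIMSEQ_iff)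

lemma r_num_admissible:
  assumes "x \<ge> 1"
  shows "admissible m (r_vec m x)"
proof (cases "x \<in> \<rat>")
  case True
  then show ?thesis using r_rat_admissible[OF True assms, of m] by (simp add: r_num_def)
next
  case False
  have adm: "admissible m (\<lambda>j. r_rat j m (cf_convergent x n))" for n
    using assms False by (intro r_rat_admissible cf_convergent_Rats cf_convergent_ge_1)
  note lim = r_num_limit_ge_1[OF False assms]
  have "r_num 0 m x = 1"
    using lim[of 0 m] adm by (simp add: admissible_def LIMSEQ_const_iff)
  moreover have "r_num j m x \<le> r_num k m x" if "j \<le> k" "k \<le> m" for j k
    using adm that unfolding admissible_def mono_on_def
    by (intro LIMSEQ_le[OF lim lim]) auto
  ultimately show ?thesis by (auto simp: admissible_def mono_on_def)
qed

lemma r_num_of_int: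
  assumes "i \<le> m" shows "r_num i m (of_int c) = multichoose c (int i)"
  using assms by (simp add: r_num_def r_rat_of_int)

text \<open>
  For irrational \<open>x\<close> only the partial quotient of index 0 can be nonpositive. Hence \<open>1 / frac x\<close> is in
  the range where the limit exists, and the continuous step carries this limit over to \<open>x\<close>.
\<close>
lemma r_num_step:
  assumes "x \<notin> \<int>" "i \<le> m"
  shows "r_num i m x = cf_step m \<lfloor>x\<rfloor> (r_vec m (1 / frac x)) i"
proof (cases "x \<in> \<rat>")
  case True
  then show ?thesis using r_rat_step[OF True assms] by (simp add: r_num_def inverse_frac_Rats)
next
  case False
  define y where "y = 1 / frac x"
  have y: "y \<notin> \<rat>" "y \<ge> 1"
    using False by (auto simp: y_def inverse_frac_Rats inverse_frac_ge_1)
  have "(\<lambda>n. cf_step m \<lfloor>x\<rfloor> (\<lambda>j. r_rat j m (cf_convergent y n)) i)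
      \<longlonglongrightarrow> cf_step m \<lfloor>x\<rfloor> (r_vec m y) i"
    using admissible_pos[OF r_num_admissible[OF y(2)], of m m] assms(2)
    by (intro tendsto_cf_step r_num_limit_ge_1 y) auto
  then have "(\<lambda>n. r_rat i m (cf_convergent x (Suc n))) \<longlonglongrightarrow> cf_step m \<lfloor>x\<rfloor> (r_vec m y) i"
    using False assms(2) by (simp add: r_rat_convergent_Suc y_def)
  then have "(\<lambda>n. r_rat i m (cf_convergent x n)) \<longlonglongrightarrow> cf_step m \<lfloor>x\<rfloor> (r_vec m y) i"
    by (rule LIMSEQ_imp_Suc)
  then show ?thesis using False by (simp add: r_num_def limI y_def)
qed

lemma r_num_step_interval:
  assumes "of_int c < x" "x < of_int c + 1" "i \<le> m"
  shows "r_num i m x = cf_step m c (r_vec m (1 / (x - of_int c))) i"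
proof -
  have fl: "\<lfloor>x\<rfloor> = c" using assms by (intro floor_unique) auto
  then have "frac x = x - of_int c" by (simp add: frac_def)
  moreover have "x \<notin> \<int>" using assms by (metis calculation diff_gt_0_iff_gt frac_eq_0_iff less_irrefl)
  ultimately show ?thesis using r_num_step[OF _ assms(3)] fl by metis
qed

section \<open>Transfer of continuity along the recursion\<close>

lemma floor_strict_bounds:
  assumes "(x::real) \<notin> \<int>"
  shows "of_int \<lfloor>x\<rfloor> < x" "x < of_int \<lfloor>x\<rfloor> + 1"
  using assms frac_gt_0_iff[of x] by (auto simp: frac_def)

text \<open>
  The recursion step is continuous because its denominator \<open>r_num m m\<close> is positive at the
  argument \<open>1 / frac x\<close>, which exceeds 1.
\<close>
lemma isCont_non_integer:
  assumes "x \<notin> \<int>" "\<And>j. j \<le> m \<Longrightarrow> isCont (r_num j m) (1 / frac x)" "i \<le> m"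
  shows "isCont (r_num i m) x"
proof -
  define c where "c = \<lfloor>x\<rfloor>"
  have x: "of_int c < x" "x < of_int c + 1"
    unfolding c_def by (rule floor_strict_bounds[OF assms(1)])+
  have y: "1 / frac x = 1 / (x - of_int c)" by (simp add: frac_def c_def)
  have "((\<lambda>t. r_num j m (1 / (t - of_int c))) \<longlongrightarrow> r_num j m (1 / (x - of_int c))) (at x)" if "j \<le> m" for j
    using x by (intro isCont_tendsto_compose[OF assms(2)[OF that, unfolded y]] tendsto_intros) auto
  moreover have "r_num m m (1 / (x - of_int c)) \<noteq> 0"
    using admissible_pos[OF r_num_admissible, of "1 / (x - of_int c)" m m] x by simp
  ultimately have "((\<lambda>t. cf_step m c (r_vec m (1 / (t - of_int c))) i)
      \<longlongrightarrow> cf_step m c (r_vec m (1 / (x - of_int c))) i) (at x)"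
    using assms(3) by (intro tendsto_cf_step)
  moreover have "\<forall>\<^sub>F t in at x. cf_step m c (r_vec m (1 / (t - of_int c))) i = r_num i m t"
    using order_tendstoD(1)[OF tendsto_ident_at x(1)] order_tendstoD(2)[OF tendsto_ident_at x(2)]
    by eventually_elim (simp add: r_num_step_interval assms(3))
  ultimately show ?thesis
    unfolding isCont_def r_num_step_interval[OF x assms(3)] by (rule Lim_transform_eventually)
qed

section \<open>Continuity at irrational numbers\<close>

text \<open>
  Numbers near \<open>x\<close> have the same first two partial quotients \<open>a\<close> and \<open>b\<close>, and the tail \<open>Z t\<close> after them
  depends continuously on \<open>t\<close>. So the estimate near the tail \<open>z\<close> of \<open>x\<close> pulls back to one near \<open>x\<close>.
\<close>
lemma close_near_irrational:
  assumes "x \<notin> \<rat>" "x > 1"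
  shows "\<forall>\<^sub>F t in nhds x. close_rays m (gap m N) (r_vec m t) (r_vec m x)"
  using assms
proof (induction N arbitrary: x rule: less_induct)
  case (less N x)
  define a where "a = \<lfloor>x\<rfloor>"
  define y where "y = 1 / (x - of_int a)"
  define b where "b = \<lfloor>y\<rfloor>"
  define z where "z = 1 / (y - of_int b)"
  have y: "y = 1 / frac x" and z: "z = 1 / frac y" by (simp_all add: y_def z_def frac_def a_def b_def)
  have irr: "y \<notin> \<rat>" "z \<notin> \<rat>" using less.prems by (auto simp: y z inverse_frac_Rats)
  then have nonint: "x \<notin> \<int>" "y \<notin> \<int>" using less.prems Ints_subset_Rats by auto
  have gt: "y > 1" "z > 1"
    unfolding z unfolding y by (rule inverse_frac_gt_1, use nonint y in simp)+
  have ab: "a \<ge> 1" "b \<ge> 1" using less.prems gt by (auto simp: a_def b_def le_floor_iff)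
  have x_int: "of_int a < x" "x < of_int a + 1"
    unfolding a_def by (rule floor_strict_bounds[OF nonint(1)])+
  have y_int: "of_int b < y" "y < of_int b + 1"
    unfolding b_def by (rule floor_strict_bounds[OF nonint(2)])+
  define Y where "Y = (\<lambda>t::real. 1 / (t - of_int a))"
  define Z where "Z = (\<lambda>t. 1 / (Y t - of_int b))"
  have two: "r_num i m t = cf_step m a (cf_step m b (r_vec m (Z t))) i"
    if "i \<le> m" "of_int a < t" "t < of_int a + 1" "of_int b < Y t" "Y t < of_int b + 1" for i t
    unfolding r_num_step_interval[OF that(2,3,1)] Z_def
    by (intro cf_step_cong that) (use that in \<open>simp add: r_num_step_interval Y_def\<close>)
  have YZ: "Y x = y" "Z x = z" by (simp_all add: Y_def Z_def y_def z_def)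
  have id: "((\<lambda>t. t) \<longlongrightarrow> x) (nhds x)" by (rule filterlim_ident)
  have Y: "(Y \<longlongrightarrow> y) (nhds x)"
    unfolding Y_def y_def using x_int by (intro tendsto_intros id) auto
  have Z: "(Z \<longlongrightarrow> z) (nhds x)"
    unfolding Z_def z_def using y_int by (intro tendsto_intros Y) auto
  have "\<forall>\<^sub>F t in nhds x. N = 0 \<or> close_rays m (gap m (N - 1)) (r_vec m (Z t)) (r_vec m z)"
  proof (cases "N = 0")
    case False
    then have "\<forall>\<^sub>F t in nhds z. close_rays m (gap m (N - 1)) (r_vec m t) (r_vec m z)"
      by (intro less.IH irr gt) auto
    then have "\<forall>\<^sub>F t in nhds x. close_rays m (gap m (N - 1)) (r_vec m (Z t)) (r_vec m z)"
      using Z by (rule eventually_compose_filterlim)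
    then show ?thesis by eventually_elim simp
  qed simp
  then show ?case
    using order_tendstoD(1)[OF id x_int(1)] order_tendstoD(2)[OF id x_int(2)]
      order_tendstoD(1)[OF Y y_int(1)] order_tendstoD(2)[OF Y y_int(2)] order_tendstoD(1)[OF Z gt(2)]
  proof eventually_elim
    case (elim t)
    have "close_rays m (gap m N) (cf_step m a (cf_step m b (r_vec m (Z t)))) (cf_step m a (cf_step m b (r_vec m z)))"
      using elim gt ab by (intro close_rays_cf_step_twice_gap r_num_admissible) auto
    moreover have "r_num i m t = cf_step m a (cf_step m b (r_vec m (Z t))) i" if "i \<le> m" for i
      using elim by (intro two that) auto
    moreover have "r_num i m x = cf_step m a (cf_step m b (r_vec m z)) i" if "i \<le> m" for i
      using two[OF that x_int] y_int by (simp add: YZ)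
    ultimately show ?case unfolding close_rays_def by auto
  qed
qed

lemma isCont_irrational_gt_1:
  assumes "x \<notin> \<rat>" "x > 1" "i \<le> m"
  shows "isCont (r_num i m) x"
  unfolding isCont_def
proof (rule tendstoI)
  fix e :: real assume "e > 0"
  then obtain N where N: "gap m N * r_num i m x < e" by (rule gap_less)
  have "\<forall>\<^sub>F t in nhds x. t > 1" by (rule order_tendstoD(1)[OF filterlim_ident assms(2)])
  with close_near_irrational[OF assms(1,2), of m N]
  have "\<forall>\<^sub>F t in nhds x. dist (r_num i m t) (r_num i m x) < e"
  proof eventually_elim
    case (elim t)
    show ?case
      using close_rays_normalized[OF elim(1) gap_nonneg r_num_admissible r_num_admissible assms(3)]
        elim(2) assms(2) N by (simp add: dist_real_def)
  qed
  then show "\<forall>\<^sub>F t in at x. dist (r_num i m t) (r_num i m x) < e"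
    by (simp add: eventually_at_filter eventually_mono)
qed

lemma isCont_irrational:
  assumes "x \<notin> \<rat>" "i \<le> m"
  shows "isCont (r_num i m) x"
proof -
  have nonint: "x \<notin> \<int>" using assms Ints_subset_Rats by auto
  have "1 / frac x \<notin> \<rat>" using assms by (simp only: inverse_frac_Rats not_False_eq_True)
  then show ?thesis
    by (intro isCont_non_integer[OF nonint _ assms(2)] isCont_irrational_gt_1
          inverse_frac_gt_1[OF nonint])
qed

section \<open>Continuity at integers and rational numbers\<close>

text \<open>
  For an integer, the vector is the image of the last unit vector, which plays the part of the
  vector of a tail at infinity. Thus the growth estimate applies to integers and other numbers alike.
\<close>
lemma r_num_growth:
  assumes "x \<ge> 1" "j < m"
  shows "of_int \<lfloor>x\<rfloor> * r_num j m x \<le> of_nat m * r_num m m x"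
proof -
  have c: "\<lfloor>x\<rfloor> \<ge> 1" using assms by (simp add: le_floor_iff)
  show ?thesis
  proof (cases "x \<in> \<int>")
    case True
    then have x: "x = of_int \<lfloor>x\<rfloor>" by (auto elim: Ints_cases)
    have "Lambda_op m \<lfloor>x\<rfloor> (\<lambda>k. if k = m then 1 else 0) i = r_num i m x" if "i \<le> m" for i
    proof -
      have "Lambda_op m \<lfloor>x\<rfloor> (\<lambda>k. if k = m then 1 else 0) i =
          (\<Sum>q\<le>i. if q = 0 then multichoose \<lfloor>x\<rfloor> (int i) else 0)"
        unfolding Lambda_op_def using that assms by (intro sum.cong) auto
      then show ?thesis using r_num_of_int[OF that, of "\<lfloor>x\<rfloor>"] x by simp
    qed
    then show ?thesis
      using Lambda_op_growth[OF c, of m "\<lambda>k. if k = m then 1 else 0" j] assms(2) by simp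
  next
    case False
    define w where "w = r_vec m (1 / frac x)"
    have pos: "w k > 0" if "k \<le> m" for k
      unfolding w_def using inverse_frac_gt_1[OF False] that
      by (intro admissible_pos[OF r_num_admissible]) auto
    have "of_int \<lfloor>x\<rfloor> * Lambda_op m \<lfloor>x\<rfloor> w j \<le> of_nat m * Lambda_op m \<lfloor>x\<rfloor> w m"
      by (intro Lambda_op_growth c less_imp_le[OF pos] assms(2))
    then have "of_int \<lfloor>x\<rfloor> * Lambda_op m \<lfloor>x\<rfloor> w j / w m \<le> of_nat m * Lambda_op m \<lfloor>x\<rfloor> w m / w m"
      using pos[of m] by (intro divide_right_mono) auto
    then show ?thesis
      using r_num_step[OF False, of j m] r_num_step[OF False, of m m] assms(2)
      by (simp add: cf_step_def w_def)
  qed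
qed

text \<open>
  By \<open>r_num_growth\<close> the quotient is at most \<open>m / \<lfloor>y\<rfloor>\<close>.
\<close>
lemma ratio_tendsto_0:
  assumes "j < m"
  shows "((\<lambda>y. r_num j m y / r_num m m y) \<longlongrightarrow> 0) at_top"
proof (rule tendsto_0_le[where K = 1])
  show "((\<lambda>y::real. of_nat m / (y - 1)) \<longlongrightarrow> 0) at_top"
  proof (intro tendsto_divide_0[OF tendsto_const] filterlim_at_top_imp_at_infinity)
    have "\<forall>\<^sub>F y in at_top. Z \<le> y - 1" for Z :: real
      using eventually_ge_at_top[of "Z + 1"] by eventually_elim simp
    then show "filterlim (\<lambda>y::real. y - 1) at_top at_top" by (simp add: filterlim_at_top)
  qed
  show "\<forall>\<^sub>F y in at_top. norm (r_num j m y / r_num m m y) \<le> norm (of_nat m / (y - 1)) * 1"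
    using eventually_gt_at_top[of 1]
  proof eventually_elim
    case (elim y)
    have pos: "r_num j m y > 0" "r_num m m y > 0"
      using elim assms by (auto intro!: admissible_pos[OF r_num_admissible])
    have "(y - 1) * r_num j m y \<le> of_int \<lfloor>y\<rfloor> * r_num j m y"
      using pos by (intro mult_right_mono) linarith+
    also have "\<dots> \<le> of_nat m * r_num m m y"
      using elim assms by (intro r_num_growth) auto
    finally show ?case using pos elim by (simp add: field_simps)
  qed
qed

text \<open>
  Put \<open>y = 1 / (t - c)\<close>, which tends to infinity. In the recursion only the term with \<open>q = 0\<close> survives,
  because the other quotients tend to 0.
\<close>
lemma tendsto_at_right_of_int:
  assumes "i \<le> m"
  shows "(r_num i m \<longlongrightarrow> multichoose c (int i)) (at_right (of_int c))"
proof -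
  have "filterlim (\<lambda>t::real. t - of_int c) (at_right 0) (at_right (of_int c))"
    by (simp add: filterlim_at_right_to_0 filterlim_ident)
  then have top: "filterlim (\<lambda>t::real. inverse (t - of_int c)) at_top (at_right (of_int c))"
    by (rule filterlim_compose[OF filterlim_inverse_at_top_right])
  have "((\<lambda>y. r_num (m - q) m y / r_num m m y) \<longlongrightarrow> (if q = 0 then 1 else 0)) at_top" if "q \<le> m" for q
  proof (cases "q = 0")
    case True
    have "\<forall>\<^sub>F y in at_top. 1 = r_num m m y / r_num m m y"
      using eventually_ge_at_top[of 1]
    proof eventually_elim
      case (elim y)
      then have "r_num m m y > 0" by (intro admissible_pos[OF r_num_admissible]) auto
      then show ?case by simp
    qed
    then show ?thesis using True by (auto intro: Lim_transform_eventually[OF tendsto_const])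
  next
    case False
    then show ?thesis using ratio_tendsto_0[of "m - q" m] that by simp
  qed
  then have "((\<lambda>y. \<Sum>q\<le>i. multichoose c (int (i - q)) * (r_num (m - q) m y / r_num m m y))
      \<longlongrightarrow> (\<Sum>q\<le>i. multichoose c (int (i - q)) * (if q = 0 then 1 else 0))) at_top"
    using assms by (intro tendsto_intros) auto
  also have "(\<Sum>q\<le>i. multichoose c (int (i - q)) * (if q = 0 then 1 else 0)) =
      (\<Sum>q\<le>i. if q = 0 then multichoose c (int i) else 0)"
    by (intro sum.cong) auto
  also have "\<dots> = multichoose c (int i)" by simp
  also have "(\<lambda>y. \<Sum>q\<le>i. multichoose c (int (i - q)) * (r_num (m - q) m y / r_num m m y)) =
      (\<lambda>y. cf_step m c (r_vec m y) i)"
    by (simp add: cf_step_def Lambda_op_def sum_divide_distrib)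
  finally have "((\<lambda>t. cf_step m c (r_vec m (inverse (t - of_int c))) i) \<longlongrightarrow> multichoose c (int i))
      (at_right (of_int c))"
    using top by (rule filterlim_compose)
  moreover have "\<forall>\<^sub>F t in at_right (of_int c).
      cf_step m c (r_vec m (inverse (t - of_int c))) i = r_num i m t"
    using eventually_at_right_real[of "of_int c" "of_int c + 1"]
    by (auto elim!: eventually_mono simp: r_num_step_interval assms inverse_eq_divide)
  ultimately show ?thesis by (rule Lim_transform_eventually)
qed

text \<open>
  Here \<open>t = (c - 1) + 1 / y\<close> with \<open>y\<close> decreasing to 1, so the right-hand limit at 1 is the input of the
  recursion.
\<close>
lemma tendsto_at_left_of_int:
  assumes "i \<le> m"
  shows "(r_num i m \<longlongrightarrow> multichoose c (int i)) (at_left (of_int c))"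
proof -
  define Y where "Y = (\<lambda>t::real. 1 / (t - of_int (c - 1)))"
  have ev: "\<forall>\<^sub>F t in at_left (of_int c). of_int (c - 1) < t \<and> t < (of_int c :: real)"
    using eventually_at_left_real[of "of_int (c - 1)" "of_int c"] by simp
  have "(Y \<longlongrightarrow> 1 / (of_int c - of_int (c - 1))) (at_left (of_int c))"
    unfolding Y_def by (intro tendsto_intros) auto
  moreover have "\<forall>\<^sub>F t in at_left (of_int c). Y t > 1"
    using ev by eventually_elim (auto simp: Y_def field_simps)
  ultimately have Y: "filterlim Y (at_right (of_int 1)) (at_left (of_int c))"
    unfolding filterlim_at by (auto elim: eventually_mono)
  have "((\<lambda>t. cf_step m (c - 1) (r_vec m (Y t)) i)
      \<longlongrightarrow> cf_step m (c - 1) (\<lambda>j. multichoose 1 (int j)) i) (at_left (of_int c))"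
    using multichoose_ge_1[of 1 m] assms
    by (intro tendsto_cf_step filterlim_compose[OF tendsto_at_right_of_int Y]) auto
  moreover have "\<forall>\<^sub>F t in at_left (of_int c). cf_step m (c - 1) (r_vec m (Y t)) i = r_num i m t"
    using ev by eventually_elim (use assms in \<open>simp add: r_num_step_interval[of "c - 1"] Y_def\<close>)
  ultimately show ?thesis
    by (auto simp: cf_step_multichoose_1[OF assms] intro: Lim_transform_eventually)
qed

lemma isCont_integer:
  assumes "x \<in> \<int>" "i \<le> m"
  shows "isCont (r_num i m) x"
proof -
  obtain c where x: "x = of_int c" using assms(1) by (auto elim: Ints_cases)
  show ?thesis
    unfolding isCont_def x r_num_of_int[OF assms(2)]
    using tendsto_at_left_of_int[OF assms(2)] tendsto_at_right_of_int[OF assms(2)]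
    by (simp add: filterlim_split_at)
qed

lemma isCont_rational:
  assumes "x \<in> \<rat>" "i \<le> m"
  shows "isCont (r_num i m) x"
proof -
  obtain n where "cf_tail x n \<in> \<int>" using cf_terminates[OF assms(1)] by blast
  then show ?thesis using assms(2)
  proof (induction n arbitrary: x i)
    case 0
    then show ?case by (simp add: isCont_integer)
  next
    case (Suc n)
    show ?case
    proof (cases "x \<in> \<int>")
      case True
      then show ?thesis using Suc.prems by (simp add: isCont_integer)
    next
      case False
      then show ?thesis
        by (rule isCont_non_integer[OF _ Suc.IH[OF Suc.prems(1)[unfolded cf_tail_Suc_shift]] Suc.prems(2)])
    qed
  qed
qed

theorem corollary4:
  fixes m i :: nat
  assumes "m > 1" and "1 \<le> i" and "i \<le> m"
  shows "\<forall>x::real. isCont (r_num i m) x"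
  using isCont_rational isCont_irrational assms(3) by blast

end
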